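(* Let $\delta \in (0,1)$. Let $\varepsilon_a \in (0,1)$ and $\varepsilon_r \in (0,1)$ be real numbers such that $\frac{\varepsilon_a}{\varepsilon_r} + \varepsilon_a \leq \frac{1}{2}$. Let $\mu \in (0,1)$ and let $X_1, X_2, \ldots$ be random variables on a probability space $(\Omega, \mathscr{F}, \Pr)$ such that, for every positive integer $k$, almost surely $0 \leq X_k \leq 1$ and $\mathbb{E}[X_k \mid \mathscr{F}_{k-1}] = \mu$, where $\mathscr{F}_0 = \{\emptyset, \Omega\}$ and $\mathscr{F}_k$ is the $\sigma$-algebra generated by $X_1, \ldots, X_k$. For a positive integer $n$ put $\widehat{\boldsymbol{\mu}} = \frac{1}{n}\sum_{i=1}^n X_i$. Then $$\Pr\left\{ |\widehat{\boldsymbol{\mu}} - \mu| < \varepsilon_a \ \text{ or } \ \left| \frac{\widehat{\boldsymbol{\mu}} - \mu}{\mu} \right| < \varepsilon_r \right\} > 1 - \delta$$ for any such $\mu \in (0,1)$, provided that $$n > \frac{\varepsilon_r \ln \frac{2}{\delta}}{(\varepsilon_a + \varepsilon_a \varepsilon_r)\ln(1+\varepsilon_r) + (\varepsilon_r - \varepsilon_a - \varepsilon_a \varepsilon_r)\ln\left(1 - \frac{\varepsilon_a \varepsilon_r}{\varepsilon_r - \varepsilon_a}\right)}.$$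
   Context: The random variables $X_k$ are not assumed independent or identically distributed; only almost sure boundedness in $[0,1]$ and the conditional mean condition are assumed. *)

theory Defs
  imports "HOL-Probability.Probability"
begin

text \<open>
  The sigma-algebra on \<^term>\<open>space M\<close> generated by \<open>X 1, \<dots>, X k\<close>; the value
  \<open>X 0\<close> plays no role. For \<open>k = 0\<close> the generating set is empty, which gives the
  trivial sigma-algebra (see \<open>sets_gen_filtration_0\<close>).
\<close>

definition gen_filtration :: "'a measure \<Rightarrow> (nat \<Rightarrow> 'a \<Rightarrow> real) \<Rightarrow> nat \<Rightarrow> 'a measure" where
  "gen_filtration M X k =
     sigma (space M) {X i -` A \<inter> space M | i A. i \<in> {1..k} \<and> A \<in> sets borel}"

lemma space_gen_filtration [simp]: "space (gen_filtration M X k) = space M"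
  unfolding gen_filtration_def by (rule space_measure_of) auto

lemma sets_gen_filtration_0: "sets (gen_filtration M X 0) = {{}, space M}"
  by (simp add: gen_filtration_def sigma_sets_empty_eq)

lemma subalgebra_gen_filtration:
  assumes "\<And>i. i \<in> {1..k} \<Longrightarrow> X i \<in> borel_measurable M"
  shows "subalgebra M (gen_filtration M X k)"
proof -
  have "sets (gen_filtration M X k)
      = sigma_sets (space M) {X i -` A \<inter> space M | i A. i \<in> {1..k} \<and> A \<in> sets borel}"
    unfolding gen_filtration_def by (rule sets_measure_of) auto
  also have "\<dots> \<subseteq> sets M"
    by (rule sets.sigma_sets_subset) (auto intro!: measurable_sets assms)
  finally show ?thesis
    by (simp add: subalgebra_def)
qed

definition sample_mean :: "(nat \<Rightarrow> 'a \<Rightarrow> real) \<Rightarrow> nat \<Rightarrow> 'a \<Rightarrow> real" where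
  "sample_mean X n \<omega> = (1 / real n) * (\<Sum>i = 1..n. X i \<omega>)"

end

theory Submission
  imports Defs
begin

text \<open>
  Conditioning step by step and using convexity of \<open>exp\<close> on \<open>[0, 1]\<close>, the sum of the \<open>X i\<close> has a
  moment generating function bounded by that of a binomial variable, which gives both Chernoff
  tails \<open>exp (- n * bernoulli_kl z \<mu>)\<close>. The bad event is a deviation of the mean by at least
  \<open>m = max \<epsilon>\<^sub>a (\<epsilon>\<^sub>r * \<mu>)\<close>. The worst case is an upward deviation at the crossover point
  \<open>q = \<epsilon>\<^sub>a / \<epsilon>\<^sub>r\<close>, and \<open>\<epsilon>\<^sub>r * bernoulli_kl (q + \<epsilon>\<^sub>a) q\<close> is the denominator of the bound on \<open>n\<close>.
  Divergences are compared along segments: \<open>t \<mapsto> bernoulli_kl (p + c * t) p\<close> vanishes to first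
  order at 0 and has second derivative \<open>c\<^sup>2 / (x * (1 - x))\<close> with \<open>x = p + c * t\<close>, so it suffices to
  compare these second derivatives pointwise.
\<close>

section \<open>Kullback-Leibler divergence of the Bernoulli laws with means \<open>z\<close> and
  \<open>p\<close>, and its derivatives in \<open>z\<close>\<close>

definition bernoulli_kl :: "real \<Rightarrow> real \<Rightarrow> real" where
  "bernoulli_kl z p = z * ln (z / p) + (1 - z) * ln ((1 - z) / (1 - p))"

text \<open>Gibbs' inequality, from \<open>ln x \<le> x - 1\<close> in both terms. It is strict in
  the first term because \<open>p / z\<close> differs from 1. Positivity is what lets the bound on
  \<open>n\<close> be multiplied out.\<close>

lemma bernoulli_kl_pos:
  assumes "0 < p" "p < 1" "0 < z" "z < 1" "z \<noteq> p"
  shows "0 < bernoulli_kl z p"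
proof -
  have "ln (p / z) < p / z - 1"
  proof -
    have "ln (p / z) \<le> p / z - 1" "ln (p / z) \<noteq> p / z - 1"
      using assms ln_le_minus_one[of "p / z"] ln_eq_minus_one[of "p / z"] by auto
    then show ?thesis by linarith
  qed
  moreover have "ln ((1 - p) / (1 - z)) \<le> (1 - p) / (1 - z) - 1"
    using assms by (intro ln_le_minus_one) auto
  ultimately have "z * ln (p / z) + (1 - z) * ln ((1 - p) / (1 - z))
      < z * (p / z - 1) + (1 - z) * ((1 - p) / (1 - z) - 1)"
    using assms by (intro add_less_le_mono mult_strict_left_mono mult_left_mono) auto
  also have "\<dots> = 0"
    using assms by (simp add: field_simps)
  finally show ?thesis
    using assms by (simp add: bernoulli_kl_def ln_div algebra_simps)
qed

lemma DERIV_ln_ratio: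
  fixes p z :: real
  assumes "0 < p" "0 < z"
  shows "((\<lambda>z. ln (z / p)) has_real_derivative 1 / z) (at z)"
  using assms by (auto intro!: derivative_eq_intros simp: field_simps)

lemma DERIV_ln_compl_ratio:
  fixes p z :: real
  assumes "p < 1" "z < 1"
  shows "((\<lambda>z. ln ((1 - z) / (1 - p))) has_real_derivative - 1 / (1 - z)) (at z)"
proof -
  have "((\<lambda>z. 1 - z) has_real_derivative - 1) (at z)"
    by (auto intro!: derivative_eq_intros)
  from DERIV_chain2[where f = "\<lambda>z. ln (z / (1 - p))", OF DERIV_ln_ratio this] assms
  show ?thesis by simp
qed

lemma DERIV_bernoulli_kl:
  assumes "0 < p" "p < 1" "0 < z" "z < 1"
  shows "((\<lambda>z. bernoulli_kl z p) has_real_derivative ln (z / p) - ln ((1 - z) / (1 - p))) (at z)"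
proof -
  have "((\<lambda>z. 1 - z) has_real_derivative - 1) (at z)"
    by (auto intro!: derivative_eq_intros)
  from DERIV_add[OF DERIV_mult[OF DERIV_ident DERIV_ln_ratio] DERIV_mult[OF this DERIV_ln_compl_ratio]]
  show ?thesis
    unfolding bernoulli_kl_def using assms by (auto elim!: DERIV_cong)
qed

lemma continuous_bernoulli_kl:
  assumes "0 < p" "p < 1" "0 < z" "z < 1"
  shows "isCont (\<lambda>z. bernoulli_kl z p) z"
  using DERIV_isCont[OF DERIV_bernoulli_kl[OF assms]] .

lemma DERIV2_bernoulli_kl:
  fixes p z :: real
  assumes "0 < p" "p < 1" "0 < z" "z < 1"
  shows "((\<lambda>z. ln (z / p) - ln ((1 - z) / (1 - p))) has_real_derivative 1 / (z * (1 - z))) (at z)"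
proof -
  have "1 / z - - 1 / (1 - z) = 1 / (z * (1 - z))" using assms by (simp add: field_simps)
  with DERIV_diff[OF DERIV_ln_ratio[of p z] DERIV_ln_compl_ratio[of p z]] assms show ?thesis
    by simp
qed

section \<open>Divergences along segments and their comparison\<close>

lemma DERIV_bernoulli_kl_line:
  assumes "0 < p" "p < 1" "0 < p + c * t" "p + c * t < 1"
  shows "((\<lambda>t. bernoulli_kl (p + c * t) p) has_real_derivative
     c * (ln ((p + c * t) / p) - ln ((1 - (p + c * t)) / (1 - p)))) (at t)"
proof -
  have "((\<lambda>t. p + c * t) has_real_derivative c) (at t)"
    by (auto intro!: derivative_eq_intros)
  from DERIV_chain2[OF DERIV_bernoulli_kl[OF assms] this] show ?thesis
    by (simp add: mult.commute)
qed

lemma DERIV2_bernoulli_kl_line: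
  assumes "0 < p" "p < 1" "0 < p + c * t" "p + c * t < 1"
  shows "((\<lambda>t. c * (ln ((p + c * t) / p) - ln ((1 - (p + c * t)) / (1 - p))))
     has_real_derivative c\<^sup>2 / ((p + c * t) * (1 - (p + c * t)))) (at t)"
proof -
  have "((\<lambda>t. p + c * t) has_real_derivative c) (at t)"
    by (auto intro!: derivative_eq_intros)
  from DERIV_cmult[OF DERIV_chain2[OF DERIV2_bernoulli_kl[OF assms] this], of c] show ?thesis
    by (simp add: power2_eq_square)
qed

lemma convex_combination_bounds:
  fixes p c t :: real
  assumes "0 < p" "p < 1" "0 < p + c" "p + c < 1" "0 \<le> t" "t \<le> 1"
  shows "0 < p + c * t" "p + c * t < 1"
proof -
  have e: "p + c * t = (1 - t) * p + t * (p + c)" by (simp add: algebra_simps)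
  show "0 < p + c * t"
    unfolding e using assms
    by (cases "t = 0") (auto intro!: add_nonneg_pos)
  have "1 - (p + c * t) = (1 - t) * (1 - p) + t * (1 - (p + c))" by (simp add: algebra_simps)
  also have "\<dots> > 0"
    using assms by (cases "t = 0") (auto intro!: add_nonneg_pos mult_pos_pos)
  finally show "p + c * t < 1" by simp
qed

text \<open>The premise \<open>le\<close> is \<open>0 \<le> h2 t\<close> with denominators cleared.
  Since \<open>h\<close> and its derivative \<open>h1\<close> both vanish at 0, monotonicity applied
  twice carries this sign from \<open>h2\<close> to \<open>h1\<close> and on to
  \<open>h\<close>.\<close>

lemma bernoulli_kl_mono:
  assumes p: "0 < p" "p < 1" "0 < p + c" "p + c < 1"
    and q: "0 < q" "q < 1" "0 < q + d" "q + d < 1"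
    and le: "\<And>t. 0 \<le> t \<Longrightarrow> t \<le> 1 \<Longrightarrow>
      d\<^sup>2 * ((p + c * t) * (1 - (p + c * t))) \<le> c\<^sup>2 * ((q + d * t) * (1 - (q + d * t)))"
  shows "bernoulli_kl (q + d) q \<le> bernoulli_kl (p + c) p"
proof -
  define h where "h t = bernoulli_kl (p + c * t) p - bernoulli_kl (q + d * t) q" for t
  define h1 where "h1 t = c * (ln ((p + c * t) / p) - ln ((1 - (p + c * t)) / (1 - p)))
     - d * (ln ((q + d * t) / q) - ln ((1 - (q + d * t)) / (1 - q)))" for t
  define h2 where "h2 t = c\<^sup>2 / ((p + c * t) * (1 - (p + c * t)))
     - d\<^sup>2 / ((q + d * t) * (1 - (q + d * t)))" for t
  note bp = convex_combination_bounds[OF p] and bq = convex_combination_bounds[OF q]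
  have h: "(h has_real_derivative h1 t) (at t)" if "0 \<le> t" "t \<le> 1" for t
    unfolding h_def h1_def using p q bp[OF that] bq[OF that]
    by (intro DERIV_diff DERIV_bernoulli_kl_line)
  have h1: "(h1 has_real_derivative h2 t) (at t)" if "0 \<le> t" "t \<le> 1" for t
    unfolding h1_def h2_def using p q bp[OF that] bq[OF that]
    by (intro DERIV_diff DERIV2_bernoulli_kl_line)
  have h2: "0 \<le> h2 t" if "0 \<le> t" "t \<le> 1" for t
  proof -
    have frac: "0 \<le> x / A - y / B" if "0 < A" "0 < B" "y * A \<le> x * B" for A B x y :: real
      using that by (simp add: field_simps)
    show ?thesis
      unfolding h2_def using bp[OF that] bq[OF that] le[OF that] by (intro frac mult_pos_pos) auto
  qed
  have "0 \<le> h1 t" if t: "0 \<le> t" "t \<le> 1" for t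
  proof -
    have "h1 0 \<le> h1 t"
      using t by (intro DERIV_nonneg_imp_nondecreasing[of 0 t h1]) (auto intro!: h1 h2 exI)
    moreover have "h1 0 = 0" using p q by (simp add: h1_def)
    ultimately show ?thesis by simp
  qed
  then have "h 0 \<le> h 1"
    by (intro DERIV_nonneg_imp_nondecreasing[of 0 1 h]) (auto intro!: h exI)
  moreover have "h 0 = 0" using p q by (simp add: h_def bernoulli_kl_def)
  ultimately show ?thesis by (simp add: h_def)
qed

text \<open>Convexity puts \<open>exp\<close> below its chord from 0 to \<open>l\<close>. The bound
  is affine in \<open>x\<close>, so its conditional expectation depends on the conditional mean
  alone.\<close>

lemma exp_scale_le_chord:
  fixes l x :: real
  assumes "0 \<le> x" "x \<le> 1"
  shows "exp (l * x) \<le> 1 + (exp l - 1) * x"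
proof -
  have "exp ((1 - x) *\<^sub>R 0 + x *\<^sub>R l) \<le> (1 - x) * exp 0 + x * exp l"
    using assms by (intro convex_onD[OF exp_convex]) auto
  then show ?thesis by (simp add: algebra_simps)
qed

section \<open>Moment generating function of the partial sums\<close>

locale bounded_cond_mean_process = prob_space M for M :: "'a measure" +
  fixes X :: "nat \<Rightarrow> 'a \<Rightarrow> real" and \<mu> :: real
  assumes \<mu>: "0 < \<mu>" "\<mu> < 1"
    and meas [measurable]: "\<And>k. k \<ge> 1 \<Longrightarrow> X k \<in> borel_measurable M"
    and bounds: "\<And>k. k \<ge> 1 \<Longrightarrow> AE \<omega> in M. 0 \<le> X k \<omega> \<and> X k \<omega> \<le> 1"
    and cond_mean: "\<And>k. k \<ge> 1 \<Longrightarrow>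
      AE \<omega> in M. real_cond_exp M (gen_filtration M X (k - 1)) (X k) \<omega> = \<mu>"
begin

definition S :: "nat \<Rightarrow> 'a \<Rightarrow> real" where "S k \<omega> = (\<Sum>i = 1..k. X i \<omega>)"

lemma S_measurable [measurable]: "S k \<in> borel_measurable M"
  unfolding S_def by (intro borel_measurable_sum meas) auto

text \<open>This is what allows \<open>exp (l * S k \<omega>)\<close> to be moved in and out of the
  conditional expectation of \<open>X (Suc k)\<close>.\<close>

lemma S_adapted: "S k \<in> borel_measurable (gen_filtration M X k)"
proof -
  have "X i \<in> borel_measurable (gen_filtration M X k)" if "i \<in> {1..k}" for i
  proof (rule measurableI)
    fix A :: "real set" assume "A \<in> sets borel"
    moreover have "sets (gen_filtration M X k)
      = sigma_sets (space M) {X i -` A \<inter> space M | i A. i \<in> {1..k} \<and> A \<in> sets borel}"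
      unfolding gen_filtration_def by (rule sets_measure_of) auto
    ultimately show "X i -` A \<inter> space (gen_filtration M X k) \<in> sets (gen_filtration M X k)"
      using that by (auto intro!: sigma_sets.Basic)
  qed auto
  then show ?thesis unfolding S_def by (intro borel_measurable_sum) auto
qed

lemma bounds_Suc: "AE \<omega> in M. 0 \<le> X (Suc k) \<omega> \<and> X (Suc k) \<omega> \<le> 1"
  by (rule bounds) simp

lemma S_bounds: "AE \<omega> in M. 0 \<le> S k \<omega> \<and> S k \<omega> \<le> real k"
proof -
  have "AE \<omega> in M. \<forall>i\<in>{1..k}. 0 \<le> X i \<omega> \<and> X i \<omega> \<le> 1"
    by (intro AE_finite_allI bounds) auto
  then show ?thesis
  proof eventually_elim
    case (elim \<omega>)
    then show ?case
      using sum_mono[of "{1..k}" "\<lambda>i. X i \<omega>" "\<lambda>_. 1"] by (auto simp: S_def intro!: sum_nonneg)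
  qed
qed

lemma exp_S_bound: "AE \<omega> in M. exp (l * S k \<omega>) \<le> exp (\<bar>l\<bar> * real k)"
  using S_bounds[of k]
proof eventually_elim
  case (elim \<omega>)
  have "l * S k \<omega> \<le> \<bar>l\<bar> * S k \<omega>" using elim by (intro mult_right_mono) auto
  also have "\<dots> \<le> \<bar>l\<bar> * real k" using elim by (intro mult_left_mono) auto
  finally show ?case by simp
qed

lemma integrable_exp_S: "integrable M (\<lambda>\<omega>. exp (l * S k \<omega>))"
  by (rule integrable_const_bound[where B = "exp (\<bar>l\<bar> * real k)"])
    (use exp_S_bound in auto)

lemma integrable_exp_S_mult_X: "integrable M (\<lambda>\<omega>. exp (l * S k \<omega>) * X (Suc k) \<omega>)"
proof (rule integrable_const_bound[where B = "exp (\<bar>l\<bar> * real k)"])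
  show "AE \<omega> in M. norm (exp (l * S k \<omega>) * X (Suc k) \<omega>) \<le> exp (\<bar>l\<bar> * real k)"
    using exp_S_bound[of l k] bounds_Suc[of k]
  proof eventually_elim
    case (elim \<omega>)
    then have "exp (l * S k \<omega>) * X (Suc k) \<omega> \<le> exp (\<bar>l\<bar> * real k) * 1"
      by (intro mult_mono) auto
    then show ?case using elim by (simp add: abs_mult)
  qed
qed (use meas[of "Suc k"] in measurable)

lemma integral_exp_S_mult_X:
  "(\<integral>\<omega>. exp (l * S k \<omega>) * X (Suc k) \<omega> \<partial>M) = (\<integral>\<omega>. exp (l * S k \<omega>) \<partial>M) * \<mu>"
proof -
  interpret F: finite_measure_subalgebra M "gen_filtration M X k"
    by unfold_locales (rule subalgebra_gen_filtration, simp)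
  have "(\<integral>\<omega>. exp (l * S k \<omega>) * X (Suc k) \<omega> \<partial>M)
      = (\<integral>\<omega>. exp (l * S k \<omega>) * real_cond_exp M (gen_filtration M X k) (X (Suc k)) \<omega> \<partial>M)"
    using S_adapted[of k] by (intro F.real_cond_exp_intg(2)[symmetric] integrable_exp_S_mult_X) auto
  \<comment> \<open>\<open>cond_mean\<close> at \<open>Suc k\<close> conditions on the first
    \<open>k\<close> variables, the index for which \<open>S k\<close> is adapted.\<close>
  also have "\<dots> = (\<integral>\<omega>. exp (l * S k \<omega>) * \<mu> \<partial>M)"
    using cond_mean[of "Suc k"] by (intro integral_cong_AE) auto
  finally show ?thesis by simp
qed

text \<open>The factor \<open>1 + (exp l - 1) * \<mu>\<close> is the moment generating function of a
  Bernoulli variable of mean \<mu>; each new summand contributes at most one such factor.\<close>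

lemma mgf_S_le: "(\<integral>\<omega>. exp (l * S k \<omega>) \<partial>M) \<le> (1 + (exp l - 1) * \<mu>) ^ k"
proof (induction k)
  case 0
  then show ?case by (simp add: S_def prob_space)
next
  case (Suc k)
  have "(1 - \<mu>) + exp l * \<mu> > 0"
    using \<mu> by (intro add_pos_pos) auto
  then have pos: "1 + (exp l - 1) * \<mu> \<ge> 0" by (simp add: algebra_simps)
  have "(\<integral>\<omega>. exp (l * S (Suc k) \<omega>) \<partial>M)
      \<le> (\<integral>\<omega>. exp (l * S k \<omega>) + (exp l - 1) * (exp (l * S k \<omega>) * X (Suc k) \<omega>) \<partial>M)"
  proof (rule integral_mono_AE)
    show "AE \<omega> in M. exp (l * S (Suc k) \<omega>)
        \<le> exp (l * S k \<omega>) + (exp l - 1) * (exp (l * S k \<omega>) * X (Suc k) \<omega>)"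
      using bounds_Suc[of k]
    proof eventually_elim
      case (elim \<omega>)
      have "exp (l * S (Suc k) \<omega>) = exp (l * S k \<omega>) * exp (l * X (Suc k) \<omega>)"
        by (simp add: S_def distrib_left exp_add)
      also have "\<dots> \<le> exp (l * S k \<omega>) * (1 + (exp l - 1) * X (Suc k) \<omega>)"
        using elim by (intro mult_left_mono exp_scale_le_chord) auto
      finally show ?case by (simp add: algebra_simps)
    qed
  qed (auto intro!: integrable_exp_S integrable_exp_S_mult_X)
  also have "\<dots> = (\<integral>\<omega>. exp (l * S k \<omega>) \<partial>M) * (1 + (exp l - 1) * \<mu>)"
    by (simp add: integrable_exp_S integrable_exp_S_mult_X integral_exp_S_mult_X)
      (simp add: algebra_simps)
  also have "\<dots> \<le> (1 + (exp l - 1) * \<mu>) ^ k * (1 + (exp l - 1) * \<mu>)"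
    using Suc pos by (intro mult_right_mono) auto
  finally show ?case by (simp add: mult.commute)
qed

section \<open>Chernoff bounds for the sample mean\<close>

lemma sample_mean_S: "sample_mean X n \<omega> = S n \<omega> / real n"
  by (simp add: sample_mean_def S_def)

lemma sample_mean_measurable [measurable]: "sample_mean X n \<in> borel_measurable M"
  unfolding sample_mean_S[abs_def] by measurable

text \<open>The factor \<open>z - \<mu>\<close> selects the tail: upper for
  \<open>z > \<mu>\<close>, lower for \<open>z < \<mu>\<close>. At equality the bound is 1.\<close>

lemma chernoff:
  assumes z: "0 < z" "z < 1" and n: "n \<ge> 1"
  shows "\<P>(\<omega> in M. (z - \<mu>) * (sample_mean X n \<omega> - z) \<ge> 0) \<le> exp (- (real n * bernoulli_kl z \<mu>))"
proof -
  \<comment> \<open>The optimal exponent: the derivative of the divergence at \<open>z\<close>,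
    equivalently the log odds ratio of \<open>z\<close> and \<mu>. It has the sign of
    \<open>z - \<mu>\<close>.\<close>
  define l where "l = ln (z / \<mu>) - ln ((1 - z) / (1 - \<mu>))"
  define A where "A = {\<omega> \<in> space M. (z - \<mu>) * (sample_mean X n \<omega> - z) \<ge> 0}"
  have A [measurable]: "A \<in> sets M" unfolding A_def by measurable
  have sgn: "0 \<le> l * x" if "0 \<le> (z - \<mu>) * x" for x
  proof (cases z \<mu> rule: linorder_cases)
    case less
    then have "ln (z / \<mu>) \<le> 0" "ln ((1 - z) / (1 - \<mu>)) \<ge> 0" using z \<mu> by auto
    then show ?thesis using that less by (auto simp: l_def zero_le_mult_iff)
  next
    case equal
    then show ?thesis using z by (simp add: l_def)
  next
    case greater
    then have "ln (z / \<mu>) \<ge> 0" "ln ((1 - z) / (1 - \<mu>)) \<le> 0" using z \<mu> by auto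
    then show ?thesis using that greater by (auto simp: l_def zero_le_mult_iff)
  qed
  \<comment> \<open>Markov's inequality for the exponential, in pointwise form.\<close>
  have ind: "indicator A \<omega> \<le> exp (- (l * real n * z)) * exp (l * S n \<omega>)" for \<omega>
  proof (cases "\<omega> \<in> A")
    case True
    then have "0 \<le> l * (S n \<omega> / real n - z)"
      by (intro sgn) (simp add: A_def sample_mean_S)
    then have "0 \<le> l * (S n \<omega> / real n - z) * real n" by simp
    also have "\<dots> = - (l * real n * z) + l * S n \<omega>"
      using n by (simp add: field_simps)
    finally show ?thesis using True by (simp flip: exp_add)
  qed simp
  have "prob A = (\<integral>\<omega>. indicator A \<omega> \<partial>M)" by simp
  also have "\<dots> \<le> (\<integral>\<omega>. exp (- (l * real n * z)) * exp (l * S n \<omega>) \<partial>M)"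
    by (intro integral_mono ind integrable_mult_right integrable_exp_S) (simp add: emeasure_eq_measure)
  also have "\<dots> \<le> exp (- (l * real n * z)) * (1 + (exp l - 1) * \<mu>) ^ n"
    by (simp add: mgf_S_le)
  also have "1 + (exp l - 1) * \<mu> = exp (- ln ((1 - z) / (1 - \<mu>)))"
  proof -
    have e1: "exp l = (z / \<mu>) / ((1 - z) / (1 - \<mu>))" using z \<mu> by (simp add: l_def exp_diff)
    have e2: "exp (- ln ((1 - z) / (1 - \<mu>))) = (1 - \<mu>) / (1 - z)"
      using z \<mu> by (simp add: exp_minus)
    show ?thesis unfolding e1 e2 using z \<mu> by (simp add: field_simps)
  qed
  also have "exp (- (l * real n * z)) * exp (- ln ((1 - z) / (1 - \<mu>))) ^ n
      = exp (- (real n * bernoulli_kl z \<mu>))"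
    by (simp add: l_def bernoulli_kl_def algebra_simps flip: exp_add exp_of_nat_mult)
  finally show ?thesis unfolding A_def .
qed

text \<open>The deviation \<open>\<mu> + c\<close> may be an endpoint of \<open>[0, 1]\<close>, where the optimal Chernoff exponent
  is infinite; applying the interior bound at \<open>\<mu> + s * c\<close> and letting \<open>s\<close> tend to 1 avoids this.\<close>

lemma tail_bound:
  assumes q: "0 < q" "q < 1" "0 < q + d" "q + d < 1" and c: "c \<noteq> 0" and n: "n \<ge> 1"
    and le: "\<And>t. 0 \<le> t \<Longrightarrow> t \<le> 1 \<Longrightarrow> 0 < \<mu> + c * t \<Longrightarrow> \<mu> + c * t < 1 \<Longrightarrow>
      d\<^sup>2 * ((\<mu> + c * t) * (1 - (\<mu> + c * t))) \<le> c\<^sup>2 * ((q + d * t) * (1 - (q + d * t)))"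
  shows "\<P>(\<omega> in M. c * (sample_mean X n \<omega> - (\<mu> + c)) \<ge> 0) \<le> exp (- (real n * bernoulli_kl (q + d) q))"
proof (cases "0 \<le> \<mu> + c \<and> \<mu> + c \<le> 1")
  case False
  \<comment> \<open>The level lies outside [0, 1], beyond every value the mean takes almost surely,
    so the event is null.\<close>
  have "AE \<omega> in M. \<not> c * (sample_mean X n \<omega> - (\<mu> + c)) \<ge> 0"
    using S_bounds[of n]
  proof eventually_elim
    case (elim \<omega>)
    then have m: "0 \<le> sample_mean X n \<omega>" "sample_mean X n \<omega> \<le> 1"
      using n by (auto simp: sample_mean_S)
    from False consider "\<mu> + c < 0" | "\<mu> + c > 1" by linarith
    then show ?case
    proof cases
      case 1
      then show ?thesis using m \<mu> by (auto simp: zero_le_mult_iff)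
    next
      case 2
      then show ?thesis using m \<mu> by (auto simp: zero_le_mult_iff)
    qed
  qed
  then have "\<P>(\<omega> in M. c * (sample_mean X n \<omega> - (\<mu> + c)) \<ge> 0) = 0"
    by (subst prob_eq_0) (auto elim!: AE_mp)
  then show ?thesis by simp
next
  case True
  have bnd: "\<P>(\<omega> in M. c * (sample_mean X n \<omega> - (\<mu> + c)) \<ge> 0)
      \<le> exp (- (real n * bernoulli_kl (q + d * s) q))" if s: "0 < s" "s < 1" for s
  proof -
    have e: "\<mu> + c * s = (1 - s) * \<mu> + s * (\<mu> + c)"
      "1 - (\<mu> + c * s) = (1 - s) * (1 - \<mu>) + s * (1 - (\<mu> + c))"
      by (simp_all add: algebra_simps)
    have 1: "0 < \<mu> + c * s"
      unfolding e(1) using s True \<mu> by (intro add_pos_nonneg mult_pos_pos mult_nonneg_nonneg) auto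
    have "0 < 1 - (\<mu> + c * s)"
      unfolding e(2) using s True \<mu> by (intro add_pos_nonneg mult_pos_pos mult_nonneg_nonneg) auto
    then have 2: "\<mu> + c * s < 1" by simp
    \<comment> \<open>Reaching the level \<open>\<mu> + c\<close> entails reaching the nearer level
      \<open>\<mu> + c * s\<close>; the gap between the two products is
      \<open>s * (1 - s) * c\<^sup>2\<close>.\<close>
    have imp: "0 \<le> (\<mu> + c * s - \<mu>) * (x - (\<mu> + c * s))" if "0 \<le> c * (x - (\<mu> + c))" for x
    proof -
      have "0 \<le> s * (c * (x - (\<mu> + c))) + s * (1 - s) * c\<^sup>2"
        using that s by simp
      also have "\<dots> = (\<mu> + c * s - \<mu>) * (x - (\<mu> + c * s))"
        by (simp add: algebra_simps power2_eq_square)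
      finally show ?thesis .
    qed
    have "\<P>(\<omega> in M. c * (sample_mean X n \<omega> - (\<mu> + c)) \<ge> 0)
        \<le> \<P>(\<omega> in M. (\<mu> + c * s - \<mu>) * (sample_mean X n \<omega> - (\<mu> + c * s)) \<ge> 0)"
      using imp by (intro finite_measure_mono) auto
    also have "\<dots> \<le> exp (- (real n * bernoulli_kl (\<mu> + c * s) \<mu>))"
      by (rule chernoff[OF 1 2 n])
    also have "\<dots> \<le> exp (- (real n * bernoulli_kl (q + d * s) q))"
    proof -
      have "bernoulli_kl (q + d * s) q \<le> bernoulli_kl (\<mu> + c * s) \<mu>"
      proof (rule bernoulli_kl_mono[OF \<mu> 1 2 q(1,2)])
        show "0 < q + d * s" "q + d * s < 1" using convex_combination_bounds[OF q, of s] s by auto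
        fix t :: real assume t: "0 \<le> t" "t \<le> 1"
        \<comment> \<open>The shortened segments run through the original ones at parameter
          \<open>s * t\<close>, so \<open>le\<close> is used there and scaled by
          \<open>s\<^sup>2\<close>.\<close>
        then have st: "0 \<le> s * t" "s * t \<le> 1" using s by (auto intro: mult_le_one)
        have "0 < \<mu> + c * s * t" "\<mu> + c * s * t < 1"
          using convex_combination_bounds[OF \<mu> 1 2 t] by auto
        then have "s\<^sup>2 * (d\<^sup>2 * ((\<mu> + c * (s * t)) * (1 - (\<mu> + c * (s * t)))))
            \<le> s\<^sup>2 * (c\<^sup>2 * ((q + d * (s * t)) * (1 - (q + d * (s * t)))))"
          using le[OF st] by (intro mult_left_mono) (auto simp: mult.assoc)
        then show "(d * s)\<^sup>2 * ((\<mu> + c * s * t) * (1 - (\<mu> + c * s * t)))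
            \<le> (c * s)\<^sup>2 * ((q + d * s * t) * (1 - (q + d * s * t)))"
          by (simp add: power_mult_distrib mult_ac)
      qed
      then show ?thesis by (simp add: mult_left_mono)
    qed
    finally show ?thesis .
  qed
  \<comment> \<open>The left side of \<open>bnd\<close> does not depend on \<open>s\<close>, and
    \<open>q + d\<close> is interior, so only the right side has to be passed to the limit.\<close>
  have "isCont (\<lambda>s. bernoulli_kl (q + d * s) q) 1"
    by (rule isCont_o2[where g = "\<lambda>z. bernoulli_kl z q"])
      (use continuous_bernoulli_kl[OF q] in \<open>auto intro!: continuous_intros\<close>)
  then have "((\<lambda>s. exp (- (real n * bernoulli_kl (q + d * s) q)))
      \<longlongrightarrow> exp (- (real n * bernoulli_kl (q + d) q))) (at_left 1)"
    by (intro tendsto_intros) (auto simp: isCont_def intro: filterlim_at_within_not_equal tendsto_mono[OF at_le[of "{..<1}" UNIV]])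
  then show ?thesis
  proof (rule tendsto_lowerbound)
    show "\<forall>\<^sub>F s in at_left 1. \<P>(\<omega> in M. c * (sample_mean X n \<omega> - (\<mu> + c)) \<ge> 0)
      \<le> exp (- (real n * bernoulli_kl (q + d * s) q))"
      using eventually_at_left_real[of 0 "1::real"] by (auto elim!: eventually_mono intro!: bnd)
  qed simp
qed

end

text \<open>The difference factors as \<open>(y - x) * (1 - (x + y))\<close>. Here \<open>x\<close>
  may be negative, as can happen for a downward deviation.\<close>

lemma bernoulli_variance_mono:
  fixes x y :: real
  assumes "x \<le> y" "x + y \<le> 1"
  shows "x * (1 - x) \<le> y * (1 - y)"
proof -
  have "0 \<le> (y - x) * (1 - (x + y))" using assms by simp
  then show ?thesis by (simp add: algebra_simps)
qed

section \<open>Reduction to the crossover point and the union bound\<close>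

theorem theorem1:
  fixes \<delta> \<epsilon>\<^sub>a \<epsilon>\<^sub>r \<mu> :: real
    and M :: "'a measure"
    and X :: "nat \<Rightarrow> 'a \<Rightarrow> real"
    and n :: nat
  assumes "0 < \<delta>" "\<delta> < 1"
    and "0 < \<epsilon>\<^sub>a" "\<epsilon>\<^sub>a < 1"
    and "0 < \<epsilon>\<^sub>r" "\<epsilon>\<^sub>r < 1"
    and "\<epsilon>\<^sub>a / \<epsilon>\<^sub>r + \<epsilon>\<^sub>a \<le> 1 / 2"
    and "0 < \<mu>" "\<mu> < 1"
    and "prob_space M"
    and "\<And>k. k \<ge> 1 \<Longrightarrow> X k \<in> borel_measurable M"
    and "\<And>k. k \<ge> 1 \<Longrightarrow> AE \<omega> in M. 0 \<le> X k \<omega> \<and> X k \<omega> \<le> 1"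
    and "\<And>k. k \<ge> 1 \<Longrightarrow>
           AE \<omega> in M. real_cond_exp M (gen_filtration M X (k - 1)) (X k) \<omega> = \<mu>"
    and "n \<ge> 1"
    and "real n > \<epsilon>\<^sub>r * ln (2 / \<delta>) /
           ((\<epsilon>\<^sub>a + \<epsilon>\<^sub>a * \<epsilon>\<^sub>r) * ln (1 + \<epsilon>\<^sub>r)
             + (\<epsilon>\<^sub>r - \<epsilon>\<^sub>a - \<epsilon>\<^sub>a * \<epsilon>\<^sub>r) * ln (1 - \<epsilon>\<^sub>a * \<epsilon>\<^sub>r / (\<epsilon>\<^sub>r - \<epsilon>\<^sub>a)))"
  shows "\<P>(\<omega> in M. \<bar>sample_mean X n \<omega> - \<mu>\<bar> < \<epsilon>\<^sub>a
                 \<or> \<bar>(sample_mean X n \<omega> - \<mu>) / \<mu>\<bar> < \<epsilon>\<^sub>r) > 1 - \<delta>"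
proof -
  interpret bounded_cond_mean_process M X \<mu>
    using assms by (simp add: bounded_cond_mean_process_def bounded_cond_mean_process_axioms_def)
  define q where "q = \<epsilon>\<^sub>a / \<epsilon>\<^sub>r"
  define K where "K = bernoulli_kl (q + \<epsilon>\<^sub>a) q"
  define m where "m = max \<epsilon>\<^sub>a (\<epsilon>\<^sub>r * \<mu>)"
  have a: "\<epsilon>\<^sub>a = \<epsilon>\<^sub>r * q" using assms by (simp add: q_def)
  \<comment> \<open>The tolerance hypothesis keeps the segment from \<open>q\<close> to
    \<open>q + \<epsilon>\<^sub>a\<close> in the left half of [0, 1], where
    \<open>x * (1 - x)\<close> increases.\<close>
  have q: "0 < q" "q + \<epsilon>\<^sub>a \<le> 1 / 2" using assms by (auto simp: q_def)
  then have q1: "q < 1" "0 < q + \<epsilon>\<^sub>a" "q + \<epsilon>\<^sub>a < 1" using assms by auto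
  have m: "0 < m" using assms by (simp add: m_def)
  have K: "0 < K"
    unfolding K_def using q q1 assms by (intro bernoulli_kl_pos) auto
  have "(\<epsilon>\<^sub>a + \<epsilon>\<^sub>a * \<epsilon>\<^sub>r) * ln (1 + \<epsilon>\<^sub>r)
      + (\<epsilon>\<^sub>r - \<epsilon>\<^sub>a - \<epsilon>\<^sub>a * \<epsilon>\<^sub>r) * ln (1 - \<epsilon>\<^sub>a * \<epsilon>\<^sub>r / (\<epsilon>\<^sub>r - \<epsilon>\<^sub>a)) = \<epsilon>\<^sub>r * K"
  proof -
    have e1: "(q + \<epsilon>\<^sub>a) / q = 1 + \<epsilon>\<^sub>r" using q by (simp add: a field_simps)
    have e2: "1 - \<epsilon>\<^sub>a * \<epsilon>\<^sub>r / (\<epsilon>\<^sub>r - \<epsilon>\<^sub>a) = (1 - (q + \<epsilon>\<^sub>a)) / (1 - q)"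
    proof -
      have "\<epsilon>\<^sub>r - \<epsilon>\<^sub>a = \<epsilon>\<^sub>r * (1 - q)" by (simp add: a algebra_simps)
      then have "\<epsilon>\<^sub>a * \<epsilon>\<^sub>r / (\<epsilon>\<^sub>r - \<epsilon>\<^sub>a) = \<epsilon>\<^sub>a / (1 - q)" using assms q1 by simp
      then show ?thesis using q1 by (simp add: field_simps)
    qed
    have e3: "\<epsilon>\<^sub>r - \<epsilon>\<^sub>a - \<epsilon>\<^sub>a * \<epsilon>\<^sub>r = \<epsilon>\<^sub>r * (1 - (q + \<epsilon>\<^sub>a))" "\<epsilon>\<^sub>a + \<epsilon>\<^sub>a * \<epsilon>\<^sub>r = \<epsilon>\<^sub>r * (q + \<epsilon>\<^sub>a)"
      by (simp_all add: a algebra_simps)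
    show ?thesis unfolding K_def bernoulli_kl_def e1 e2 e3 by (simp add: distrib_left)
  qed
  \<comment> \<open>Each of the two tails is allotted half of \<delta>.\<close>
  with assms have "\<epsilon>\<^sub>r * ln (2 / \<delta>) / (\<epsilon>\<^sub>r * K) < real n" by simp
  then have "ln (2 / \<delta>) < real n * K" using assms K by (simp add: divide_less_eq)
  then have "exp (- (real n * K)) < exp (- ln (2 / \<delta>))" by simp
  also have "\<dots> = \<delta> / 2" using assms by (simp add: exp_minus)
  finally have small: "exp (- (real n * K)) < \<delta> / 2" .

  \<comment> \<open>The premise of \<open>tail_bound\<close> for the deviation \<open>g * m\<close>,
    compared with the step \<open>\<epsilon>\<^sub>a\<close> from \<open>q\<close>; \<open>g\<close>
    is the direction of the deviation.\<close>
  have curv: "\<epsilon>\<^sub>a\<^sup>2 * ((\<mu> + g * m * t) * (1 - (\<mu> + g * m * t)))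
      \<le> (g * m)\<^sup>2 * ((q + \<epsilon>\<^sub>a * t) * (1 - (q + \<epsilon>\<^sub>a * t)))"
    if t: "0 \<le> t" "t \<le> 1" and g: "g = 1 \<or> g = -1" for g t
  proof -
    have at: "0 \<le> \<epsilon>\<^sub>a * t" "\<epsilon>\<^sub>a * t \<le> \<epsilon>\<^sub>a"
      using t assms by (auto intro: mult_left_le)
    have g2: "g\<^sup>2 = 1" using g by auto
    show ?thesis
    proof (cases "\<mu> \<le> q")
      case True
      then have me: "m = \<epsilon>\<^sub>a" using assms by (simp add: m_def a)
      \<comment> \<open>Both steps have length \<open>\<epsilon>\<^sub>a\<close>, so only the
        variances at the two points are left to compare.\<close>
      have gt: "g * \<epsilon>\<^sub>a * t \<le> \<epsilon>\<^sub>a * t" using g at by auto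
      have "(\<mu> + g * m * t) * (1 - (\<mu> + g * m * t)) \<le> (q + \<epsilon>\<^sub>a * t) * (1 - (q + \<epsilon>\<^sub>a * t))"
        unfolding me using True q at gt by (intro bernoulli_variance_mono) auto
      then show ?thesis using g2 by (simp add: me power_mult_distrib mult_left_mono)
    next
      case False
      then have me: "m = \<epsilon>\<^sub>r * \<mu>" using assms by (simp add: m_def a)
      \<comment> \<open>Both steps are now relative: the points are \<open>\<mu> * u\<close> and
        \<open>q * v\<close>. After cancelling \<open>\<epsilon>\<^sub>r\<^sup>2 * q * \<mu>\<close>
        the claim is \<open>q * u * (1 - \<mu> * u) \<le> \<mu> * v * (1 - q * v)\<close>. First
        \<open>u\<close> is replaced by \<open>v\<close> at the point \<open>q\<close>, then \<mu>
        is compared with \<open>q\<close>.\<close>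
      define u where "u = 1 + g * (\<epsilon>\<^sub>r * t)"
      define v where "v = 1 + \<epsilon>\<^sub>r * t"
      have rt: "0 \<le> \<epsilon>\<^sub>r * t" "\<epsilon>\<^sub>r * t \<le> 1" using t assms by (auto intro: mult_le_one)
      then have uv: "0 \<le> u" "u \<le> v" using g by (auto simp: u_def v_def)
      have qv: "q * v \<le> 1 / 2" using q at by (simp add: v_def a algebra_simps)
      have qu: "q * u \<le> q * v" using uv q by (intro mult_left_mono) auto
      have "(q * u) * (1 - q * u) \<le> (q * v) * (1 - q * v)"
        using qv qu by (intro bernoulli_variance_mono) auto
      then have "q * (u * (1 - q * u)) \<le> q * (v * (1 - q * v))" by (simp add: mult.assoc)
      then have 1: "u * (1 - q * u) \<le> v * (1 - q * v)" using q by simp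
      \<comment> \<open>Cancelling the common term \<open>q * \<mu> * u\<close> leaves
        \<open>q \<le> \<mu>\<close>.\<close>
      have "q * (1 - \<mu> * u) \<le> \<mu> * (1 - q * u)" using False by (simp add: algebra_simps)
      then have "u * (q * (1 - \<mu> * u)) \<le> u * (\<mu> * (1 - q * u))" using uv by (intro mult_left_mono) auto
      also have "\<dots> = \<mu> * (u * (1 - q * u))" by (simp add: algebra_simps)
      also have "\<dots> \<le> \<mu> * (v * (1 - q * v))" using 1 assms by (intro mult_left_mono) auto
      finally have "(\<epsilon>\<^sub>r\<^sup>2 * q * \<mu>) * (u * (q * (1 - \<mu> * u))) \<le> (\<epsilon>\<^sub>r\<^sup>2 * q * \<mu>) * (\<mu> * (v * (1 - q * v)))"
        using q assms by (intro mult_left_mono) auto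
      moreover have "\<mu> + g * m * t = \<mu> * u" "q + \<epsilon>\<^sub>a * t = q * v" "(g * m)\<^sup>2 = \<epsilon>\<^sub>r\<^sup>2 * \<mu>\<^sup>2" "\<epsilon>\<^sub>a\<^sup>2 = \<epsilon>\<^sub>r\<^sup>2 * q\<^sup>2"
        using g2 by (simp_all add: u_def v_def me a power_mult_distrib algebra_simps)
      ultimately show ?thesis by (simp add: power2_eq_square mult_ac)
    qed
  qed
  have tail: "\<P>(\<omega> in M. g * m * (sample_mean X n \<omega> - (\<mu> + g * m)) \<ge> 0) \<le> exp (- (real n * K))"
    if g: "g = 1 \<or> g = -1" for g
    unfolding K_def using g m assms q q1 by (intro tail_bound curv) auto

  let ?good = "{\<omega> \<in> space M. \<bar>sample_mean X n \<omega> - \<mu>\<bar> < \<epsilon>\<^sub>a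
                 \<or> \<bar>(sample_mean X n \<omega> - \<mu>) / \<mu>\<bar> < \<epsilon>\<^sub>r}"
  let ?E = "\<lambda>g. {\<omega> \<in> space M. g * m * (sample_mean X n \<omega> - (\<mu> + g * m)) \<ge> 0}"
  \<comment> \<open>Failure of both tolerances means a deviation of at least \<open>m\<close>,
    upward in \<open>?E 1\<close> or downward in \<open>?E (- 1)\<close>.\<close>
  have "space M - ?good \<subseteq> ?E 1 \<union> ?E (- 1)"
  proof
    fix \<omega> assume w: "\<omega> \<in> space M - ?good"
    then have "\<epsilon>\<^sub>a \<le> \<bar>sample_mean X n \<omega> - \<mu>\<bar>" "\<epsilon>\<^sub>r * \<mu> \<le> \<bar>sample_mean X n \<omega> - \<mu>\<bar>"
      using assms by (auto simp: abs_divide not_less le_divide_eq)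
    then have "m \<le> \<bar>sample_mean X n \<omega> - \<mu>\<bar>" by (simp add: m_def)
    then have "0 \<le> sample_mean X n \<omega> - (\<mu> + m) \<or> sample_mean X n \<omega> - (\<mu> - m) \<le> 0" by auto
    then show "\<omega> \<in> ?E 1 \<union> ?E (- 1)"
      using w m by (auto simp: zero_le_mult_iff mult_le_0_iff)
  qed
  then have "prob (space M - ?good) \<le> prob (?E 1 \<union> ?E (- 1))"
    by (intro finite_measure_mono) auto
  also have "\<dots> \<le> prob (?E 1) + prob (?E (- 1))"
    by (intro measure_Un_le) auto
  also have "\<dots> < \<delta>" using tail[of 1] tail[of "- 1"] small by simp
  finally show ?thesis by (subst (asm) prob_compl) auto
qed

end
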